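(* Let $\mathcal{H}$ be a complex Hilbert space, $\mathcal{D}$ a dense subspace of $\mathcal{H}$, and $\Omega$ a sesquilinear form on $\mathcal{D}$ which is q-closed with respect to a norm $\|\cdot\|_\Omega$, with numerical range $\mathfrak{n}_\Omega$. Suppose that the following condition is satisfied: if $\{\xi_n\}$ is a sequence in $\mathcal{D}$ such that $\lim_{n\to\infty}\|\xi_n\|=0$ and $\lim_{n\to\infty}|\Omega(\xi_n,\xi_n)|=0$, then $\lim_{n\to\infty}\|\xi_n\|_\Omega=0$. Let moreover $\Upsilon$ be a bounded sesquilinear form on $\mathcal{H}$ and let $\mathfrak{n}_{-\Upsilon}$ be the numerical range of $-\Upsilon$. If $\overline{\mathfrak{n}_\Omega}\cap\overline{\mathfrak{n}_{-\Upsilon}}=\varnothing$, then $\Upsilon\in\mathfrak{P}(\Omega)$, hence $\Omega$ is solvable with respect to $\|\cdot\|_\Omega$. In particular, if $\lambda\in\mathbb{C}$ and $\lambda\notin\overline{\mathfrak{n}_\Omega}$, then $-\lambda\iota\in\mathfrak{P}(\Omega)$ and $\Omega$ is solvable with respect to $\|\cdot\|_\Omega$.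
   Context: Let $\langle\cdot|\cdot\rangle$ and $\|\cdot\|$ be the inner product and norm of $\mathcal{H}$; $\iota(\xi,\eta)=\langle\xi|\eta\rangle$. Sesquilinear forms are linear in the first variable and conjugate linear in the second. The numerical range of a form $\Omega$ on $\mathcal{D}$ is $\mathfrak{n}_\Omega=\{\Omega(\xi,\xi):\xi\in\mathcal{D},\|\xi\|=1\}$; for a bounded form on $\mathcal{H}$ the domain is $\mathcal{H}$. Bars denote closure in $\mathbb{C}$. A sesquilinear form $\Omega$ on the dense subspace $\mathcal{D}$ is q-closed with respect to a norm $\|\cdot\|_\Omega$ on $\mathcal{D}$ if: (1) there is $\alpha>0$ with $\|\xi\|\le\alpha\|\xi\|_\Omega$ for all $\xi\in\mathcal{D}$; (2) if $\{\xi_n\}\subset\mathcal{D}$, $\|\xi_n\|\to0$ and $\|\xi_n-\xi_m\|_\Omega\to0$, then $\|\xi_n\|_\Omega\to0$; (3) $\mathcal{E}_\Omega:=\mathcal{D}[\|\cdot\|_\Omega]$ is a reflexive Banach space; (4) there is $\beta>0$ with $|\Omega(\xi,\eta)|\le\beta\|\xi\|_\Omega\|\eta\|_\Omega$ for all $\xi,\eta\in\mathcal{D}$. Let $\mathcal{E}_\Omega^\times$ be the conjugate dual of $\mathcal{E}_\Omega$ (bounded conjugate linear functionals). $\mathfrak{P}(\Omega)$ is the set of bounded sesquilinear forms $\Upsilon$ on $\mathcal{H}$ such that (i) if $\xi\in\mathcal{D}$ and $(\Omega+\Upsilon)(\xi,\eta)=0$ for all $\eta\in\mathcal{D}$, then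 $\xi=0$; (ii) for every $\Lambda\in\mathcal{E}_\Omega^\times$ there is $\xi\in\mathcal{D}$ with $\Lambda(\eta)=(\Omega+\Upsilon)(\xi,\eta)$ for all $\eta\in\mathcal{D}$. $\Omega$ is solvable with respect to $\|\cdot\|_\Omega$ if it is q-closed with respect to $\|\cdot\|_\Omega$ and $\mathfrak{P}(\Omega)\neq\varnothing$. *)

theory Defs
  imports "HOL-Analysis.Analysis" "HOL-Library.Function_Algebras"
begin

section \<open>Complex Hilbert spaces\<close>

text \<open>
  The inner product is linear in the first variable and conjugate linear in the second one.
  Norm, topology and completeness are those of the superclass \<open>banach\<close>, tied to the inner product
  by \<open>cinner_self\<close> (which also gives positive definiteness).
\<close>

class complex_hilbert_space = banach +
  fixes scaleC :: "complex \<Rightarrow> 'a \<Rightarrow> 'a"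
    and cinner :: "'a \<Rightarrow> 'a \<Rightarrow> complex"
  assumes scaleC_add_right: "scaleC a (x + y) = scaleC a x + scaleC a y"
    and scaleC_add_left: "scaleC (a + b) x = scaleC a x + scaleC b x"
    and scaleC_scaleC: "scaleC a (scaleC b x) = scaleC (a * b) x"
    and scaleR_scaleC: "scaleR r x = scaleC (complex_of_real r) x"
    and cinner_add_left: "cinner (x + y) z = cinner x z + cinner y z"
    and cinner_scaleC_left: "cinner (scaleC a x) y = a * cinner x y"
    and cinner_commute: "cinner x y = cnj (cinner y x)"
    and cinner_self: "cinner x x = complex_of_real ((norm x)\<^sup>2)"

lemma vector_space_scaleC:
  "vector_space (scaleC :: complex \<Rightarrow> 'a \<Rightarrow> 'a::complex_hilbert_space)"
  using scaleR_scaleC[of 1, where 'a='a]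
  by unfold_locales (simp_all add: scaleC_add_right scaleC_add_left scaleC_scaleC)

instantiation complex :: complex_hilbert_space
begin

definition scaleC_complex :: "complex \<Rightarrow> complex \<Rightarrow> complex"
  where "scaleC_complex a x = a * x"

definition cinner_complex :: "complex \<Rightarrow> complex \<Rightarrow> complex"
  where "cinner_complex x y = x * cnj y"

instance
  by standard
    (simp_all add: scaleC_complex_def cinner_complex_def algebra_simps scaleR_conv_of_real
      complex_norm_square[symmetric])

end


section \<open>Norms, duals and reflexivity on a linear subspace\<close>

text \<open>
  A normed space is given by a scalar multiplication \<open>s\<close>, a subspace \<open>V\<close> of the type and a function
  \<open>p\<close> of which only the values on \<open>V\<close> matter. The scalar multiplication is a parameter so that the
  notions apply to the dual space as well.
\<close>

definition norm_on :: "(complex \<Rightarrow> 'b \<Rightarrow> 'b) \<Rightarrow> 'b set \<Rightarrow> ('b::ab_group_add \<Rightarrow> real) \<Rightarrow> bool"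
  where "norm_on s V p \<longleftrightarrow>
    (\<forall>x\<in>V. 0 \<le> p x) \<and>
    (\<forall>x\<in>V. p x = 0 \<longleftrightarrow> x = 0) \<and>
    (\<forall>a. \<forall>x\<in>V. p (s a x) = cmod a * p x) \<and>
    (\<forall>x\<in>V. \<forall>y\<in>V. p (x + y) \<le> p x + p y)"

definition Cauchy_wrt :: "('b::ab_group_add \<Rightarrow> real) \<Rightarrow> (nat \<Rightarrow> 'b) \<Rightarrow> bool"
  where "Cauchy_wrt p X \<longleftrightarrow> (\<forall>e>0. \<exists>N. \<forall>m\<ge>N. \<forall>n\<ge>N. p (X m - X n) < e)"

definition banach_on :: "(complex \<Rightarrow> 'b \<Rightarrow> 'b) \<Rightarrow> 'b set \<Rightarrow> ('b::ab_group_add \<Rightarrow> real) \<Rightarrow> bool"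
  where "banach_on s V p \<longleftrightarrow>
    module.subspace s V \<and> norm_on s V p \<and>
    (\<forall>X. (\<forall>n. X n \<in> V) \<and> Cauchy_wrt p X \<longrightarrow> (\<exists>x\<in>V. (\<lambda>n. p (X n - x)) \<longlonglongrightarrow> 0))"

text \<open>
  Functionals on \<open>V\<close> are represented by functions that vanish outside \<open>V\<close>; this makes the
  representation unique and the dual closed under pointwise addition and scalar multiplication.
\<close>

definition dual_on ::
    "(complex \<Rightarrow> 'b \<Rightarrow> 'b) \<Rightarrow> 'b set \<Rightarrow> ('b::ab_group_add \<Rightarrow> real) \<Rightarrow> ('b \<Rightarrow> complex) set"
  where "dual_on s V p = {f.
    (\<forall>x\<in>V. \<forall>y\<in>V. f (x + y) = f x + f y) \<and>
    (\<forall>a. \<forall>x\<in>V. f (s a x) = a * f x) \<and>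
    (\<exists>M. \<forall>x\<in>V. cmod (f x) \<le> M * p x) \<and>
    (\<forall>x. x \<notin> V \<longrightarrow> f x = 0)}"

definition conj_dual_on ::
    "(complex \<Rightarrow> 'b \<Rightarrow> 'b) \<Rightarrow> 'b set \<Rightarrow> ('b::ab_group_add \<Rightarrow> real) \<Rightarrow> ('b \<Rightarrow> complex) set"
  where "conj_dual_on s V p = {f.
    (\<forall>x\<in>V. \<forall>y\<in>V. f (x + y) = f x + f y) \<and>
    (\<forall>a. \<forall>x\<in>V. f (s a x) = cnj a * f x) \<and>
    (\<exists>M. \<forall>x\<in>V. cmod (f x) \<le> M * p x) \<and>
    (\<forall>x. x \<notin> V \<longrightarrow> f x = 0)}"

definition dual_norm :: "'b set \<Rightarrow> ('b \<Rightarrow> real) \<Rightarrow> ('b \<Rightarrow> complex) \<Rightarrow> real"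
  where "dual_norm V p f = (SUP x\<in>{x\<in>V. p x \<le> 1}. cmod (f x))"

definition scale_fun :: "complex \<Rightarrow> ('b \<Rightarrow> complex) \<Rightarrow> ('b \<Rightarrow> complex)"
  where "scale_fun a f = (\<lambda>x. a * f x)"

definition bidual_on ::
    "(complex \<Rightarrow> 'b \<Rightarrow> 'b) \<Rightarrow> 'b set \<Rightarrow> ('b::ab_group_add \<Rightarrow> real) \<Rightarrow> (('b \<Rightarrow> complex) \<Rightarrow> complex) set"
  where "bidual_on s V p = dual_on scale_fun (dual_on s V p) (dual_norm V p)"

text \<open>Reflexivity is surjectivity of the canonical embedding into the bidual.\<close>

definition reflexive_banach_on ::
    "(complex \<Rightarrow> 'b \<Rightarrow> 'b) \<Rightarrow> 'b set \<Rightarrow> ('b::ab_group_add \<Rightarrow> real) \<Rightarrow> bool"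
  where "reflexive_banach_on s V p \<longleftrightarrow>
    banach_on s V p \<and>
    (\<forall>F\<in>bidual_on s V p. \<exists>x\<in>V. \<forall>f\<in>dual_on s V p. F f = f x)"


section \<open>Sesquilinear forms\<close>

text \<open>A form on \<open>D\<close> is a function on the whole type of which only the values on \<open>D\<close> matter.\<close>

definition sesquilinear_on ::
    "'a set \<Rightarrow> ('a::complex_hilbert_space \<Rightarrow> 'a \<Rightarrow> complex) \<Rightarrow> bool"
  where "sesquilinear_on D \<Omega> \<longleftrightarrow>
    (\<forall>x\<in>D. \<forall>y\<in>D. \<forall>z\<in>D. \<Omega> (x + y) z = \<Omega> x z + \<Omega> y z) \<and>
    (\<forall>a. \<forall>x\<in>D. \<forall>y\<in>D. \<Omega> (scaleC a x) y = a * \<Omega> x y) \<and>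
    (\<forall>x\<in>D. \<forall>y\<in>D. \<forall>z\<in>D. \<Omega> x (y + z) = \<Omega> x y + \<Omega> x z) \<and>
    (\<forall>a. \<forall>x\<in>D. \<forall>y\<in>D. \<Omega> x (scaleC a y) = cnj a * \<Omega> x y)"

definition bounded_sesquilinear_form :: "('a::complex_hilbert_space \<Rightarrow> 'a \<Rightarrow> complex) \<Rightarrow> bool"
  where "bounded_sesquilinear_form \<Upsilon> \<longleftrightarrow>
    sesquilinear_on UNIV \<Upsilon> \<and> (\<exists>M. \<forall>x y. cmod (\<Upsilon> x y) \<le> M * norm x * norm y)"

definition numerical_range ::
    "'a set \<Rightarrow> ('a::complex_hilbert_space \<Rightarrow> 'a \<Rightarrow> complex) \<Rightarrow> complex set"
  where "numerical_range D \<Omega> = {\<Omega> x x |x. x \<in> D \<and> norm x = 1}"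

definition q_closed_wrt ::
    "'a set \<Rightarrow> ('a::complex_hilbert_space \<Rightarrow> 'a \<Rightarrow> complex) \<Rightarrow> ('a \<Rightarrow> real) \<Rightarrow> bool"
  where "q_closed_wrt D \<Omega> p \<longleftrightarrow>
    (\<exists>\<alpha>>0. \<forall>x\<in>D. norm x \<le> \<alpha> * p x) \<and>
    (\<forall>X. (\<forall>n. X n \<in> D) \<and> (\<lambda>n. norm (X n)) \<longlonglongrightarrow> 0 \<and> Cauchy_wrt p X
      \<longrightarrow> (\<lambda>n. p (X n)) \<longlonglongrightarrow> 0) \<and>
    reflexive_banach_on scaleC D p \<and>
    (\<exists>\<beta>>0. \<forall>x\<in>D. \<forall>y\<in>D. cmod (\<Omega> x y) \<le> \<beta> * p x * p y)"

text \<open>The set \<open>\<PP>(\<Omega>)\<close>; it depends on \<open>p\<close> through the conjugate dual.\<close>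

definition solving_forms ::
    "'a set \<Rightarrow> ('a::complex_hilbert_space \<Rightarrow> 'a \<Rightarrow> complex) \<Rightarrow> ('a \<Rightarrow> real)
      \<Rightarrow> ('a \<Rightarrow> 'a \<Rightarrow> complex) set"
  where "solving_forms D \<Omega> p = {\<Upsilon>. bounded_sesquilinear_form \<Upsilon> \<and>
    (\<forall>x\<in>D. (\<forall>y\<in>D. \<Omega> x y + \<Upsilon> x y = 0) \<longrightarrow> x = 0) \<and>
    (\<forall>\<Lambda>\<in>conj_dual_on scaleC D p. \<exists>x\<in>D. \<forall>y\<in>D. \<Lambda> y = \<Omega> x y + \<Upsilon> x y)}"

definition solvable_wrt ::
    "'a set \<Rightarrow> ('a::complex_hilbert_space \<Rightarrow> 'a \<Rightarrow> complex) \<Rightarrow> ('a \<Rightarrow> real) \<Rightarrow> bool"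
  where "solvable_wrt D \<Omega> p \<longleftrightarrow> q_closed_wrt D \<Omega> p \<and> solving_forms D \<Omega> p \<noteq> {}"

end

theory Submission
  imports Defs
begin

text \<open>
  Let \<open>A = \<Omega> + \<Upsilon>\<close>. The two closed numerical ranges are disjoint and one of them is compact, so they
  have a positive distance \<open>d\<close> and \<open>d \<parallel>x\<parallel>\<^sup>2 \<le> \<bar>A x x\<bar>\<close>. If \<open>\<bar>A x x\<bar> \<ge> c (p x)\<^sup>2\<close> failed for every
  \<open>c > 0\<close>, there would be \<open>p\<close>-unit vectors with \<open>A x x \<rightarrow> 0\<close>, hence \<open>\<parallel>x\<parallel> \<rightarrow> 0\<close>, hence
  \<open>\<Omega> x x \<rightarrow> 0\<close>, contradicting the hypothesis on sequences. So \<open>A\<close> is coercive for \<open>p\<close>, and the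
  Lax--Milgram argument applies, reflexivity replacing the Hilbert space structure.
\<close>

section \<open>Hahn--Banach on a complex subspace\<close>

text \<open>The scalar multiplication is abstract because the locale serves both \<open>D\<close> in
  the Hilbert space and the dual of \<open>D\<close> inside a function space; Hahn-Banach is applied
  in the latter.\<close>

locale complex_subspace = vector_space scale
  for scale :: "complex \<Rightarrow> 'b::ab_group_add \<Rightarrow> 'b" +
  fixes X :: "'b set"
  assumes subspace_X: "subspace X"
begin

section \<open>Sublinear functionals and their minimal elements\<close>

definition sublinear :: "('b \<Rightarrow> real) \<Rightarrow> bool"
  where "sublinear m \<longleftrightarrow>
    (\<forall>x\<in>X. \<forall>y\<in>X. m (x + y) \<le> m x + m y) \<and>
    (\<forall>t>0. \<forall>x\<in>X. m (scale (of_real t) x) \<le> t * m x)"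

lemma
  shows X_zero: "0 \<in> X"
    and X_add: "x \<in> X \<Longrightarrow> y \<in> X \<Longrightarrow> x + y \<in> X"
    and X_scale: "x \<in> X \<Longrightarrow> scale a x \<in> X"
    and X_neg: "x \<in> X \<Longrightarrow> - x \<in> X"
    and X_diff: "x \<in> X \<Longrightarrow> y \<in> X \<Longrightarrow> x - y \<in> X"
  using subspace_X by (auto simp: subspace_0 subspace_add subspace_scale subspace_neg subspace_diff)

lemma sublinear_add: "sublinear m \<Longrightarrow> x \<in> X \<Longrightarrow> y \<in> X \<Longrightarrow> m (x + y) \<le> m x + m y"
  by (simp add: sublinear_def)

text \<open>The reverse inequality is the assumed one for the factor \<open>inverse t\<close>,
  applied at the scaled point.\<close>

lemma sublinear_pos_scale:
  assumes "sublinear m" "x \<in> X" "t > 0"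
  shows "m (scale (of_real t) x) = t * m x"
proof (rule antisym)
  show "m (scale (of_real t) x) \<le> t * m x"
    using assms by (simp add: sublinear_def)
  have "m (scale (of_real (inverse t)) (scale (of_real t) x)) \<le> inverse t * m (scale (of_real t) x)"
    using assms X_scale[of x "of_real t"] unfolding sublinear_def by (metis positive_imp_inverse_positive)
  moreover have "scale (of_real (inverse t)) (scale (of_real t) x) = x"
    using \<open>t > 0\<close> by (simp flip: of_real_mult)
  ultimately show "t * m x \<le> m (scale (of_real t) x)"
    using \<open>t > 0\<close> by (simp add: field_simps)
qed

lemma sublinear_zero: "sublinear m \<Longrightarrow> m 0 = 0"
  using sublinear_pos_scale[of m 0 2] X_zero by simp

lemma sublinear_lower:
  assumes "sublinear m" "x \<in> X"
  shows "- m (- x) \<le> m x"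
  using sublinear_add[of m x "- x"] sublinear_zero[of m] assms X_neg by simp

text \<open>The witness is the infimum of \<open>m (x + t y) - t * m y\<close> over t \<ge> 0: the
  parameter 0 gives domination by \<open>m\<close>, the parameter 1 the last inequality. If
  \<open>m\<close> is minimal, then \<open>m' = m\<close> and that inequality becomes
  superadditivity.\<close>

lemma sublinear_tilt:
  assumes m: "sublinear m" and y: "y \<in> X"
  obtains m' where "sublinear m'" "\<And>x. x \<notin> X \<Longrightarrow> m' x = 0" "\<And>x. x \<in> X \<Longrightarrow> m' x \<le> m x"
    "\<And>x. x \<in> X \<Longrightarrow> m' x \<le> m (x + y) - m y"
proof -
  define h where "h x t = m (x + scale (of_real t) y) - t * m y" for x and t :: real
  define m' where "m' x = (if x \<in> X then INF t\<in>{0..}. h x t else 0)" for x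
  \<comment> \<open>A lower bound independent of \<open>t\<close> makes the infimum genuine; it
    comes from splitting \<open>t y\<close> into \<open>- x\<close> and
    \<open>x + t y\<close>.\<close>
  have h_lower: "- m (- x) \<le> h x t" if "x \<in> X" "t \<ge> 0" for x t
  proof (cases "t = 0")
    case True
    then show ?thesis using sublinear_lower[OF m that(1)] by (simp add: h_def)
  next
    case False
    then have "t * m y = m (- x + (x + scale (of_real t) y))"
      using sublinear_pos_scale[OF m y, of t] that by simp
    also have "\<dots> \<le> m (- x) + m (x + scale (of_real t) y)"
      using that y by (intro sublinear_add m X_neg X_add X_scale)
    finally show ?thesis by (simp add: h_def)
  qed
  have m'_le: "m' x \<le> h x t" if "x \<in> X" "t \<ge> 0" for x t
    unfolding m'_def using that h_lower by (auto intro!: cINF_lower bdd_belowI2[where m="- m (- x)"])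
  have m'_ge: "a \<le> m' x" if "x \<in> X" "\<And>t. t \<ge> 0 \<Longrightarrow> a \<le> h x t" for a x
    unfolding m'_def using that by (auto intro!: cINF_greatest)
  have "sublinear m'"
    unfolding sublinear_def
  proof (intro conjI ballI allI impI)
    fix x z assume x: "x \<in> X" and z: "z \<in> X"
    \<comment> \<open>The parameters \<open>t\<close> and \<open>u\<close> of the summands are
      matched by \<open>t + u\<close> for the sum; infima over \<open>u\<close> and then over
      \<open>t\<close> give subadditivity.\<close>
    have h_add: "m' (x + z) \<le> h x t + h z u" if "t \<ge> 0" "u \<ge> 0" for t u
    proof -
      have "m' (x + z) \<le> h (x + z) (t + u)"
        using x z that by (intro m'_le X_add) auto
      also have "\<dots> = m ((x + scale (of_real t) y) + (z + scale (of_real u) y)) - (t + u) * m y"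
        by (simp add: h_def scale_left_distrib algebra_simps)
      also have "\<dots> \<le> h x t + h z u"
        using sublinear_add[OF m, of "x + scale (of_real t) y" "z + scale (of_real u) y"] x y z
        by (simp add: h_def X_add X_scale algebra_simps)
      finally show ?thesis .
    qed
    have "m' (x + z) - h x t \<le> m' z" if "t \<ge> 0" for t
      using h_add[OF that] z by (intro m'_ge) (auto simp: algebra_simps)
    then have "m' (x + z) - m' z \<le> m' x"
      using x by (intro m'_ge) (auto simp: algebra_simps)
    then show "m' (x + z) \<le> m' x + m' z" by simp
  next
    fix t :: real and x assume t: "t > 0" and x: "x \<in> X"
    \<comment> \<open>Using the parameter \<open>t * u\<close> at the scaled point lets the factor
      \<open>t\<close> be pulled out of \<open>h\<close>.\<close>
    have "inverse t * m' (scale (of_real t) x) \<le> h x u" if "u \<ge> 0" for u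
    proof -
      have "m' (scale (of_real t) x) \<le> h (scale (of_real t) x) (t * u)"
        using x t that by (intro m'_le X_scale) auto
      also have "\<dots> = m (scale (of_real t) (x + scale (of_real u) y)) - t * u * m y"
        by (simp add: h_def scale_right_distrib)
      also have "\<dots> = t * h x u"
        using sublinear_pos_scale[OF m, of "x + scale (of_real u) y" t] t x y
        by (simp add: h_def X_add X_scale algebra_simps)
      finally show ?thesis using t by (simp add: field_simps)
    qed
    from m'_ge[OF x this] show "m' (scale (of_real t) x) \<le> t * m' x"
      using t by (simp add: field_simps)
  qed
  moreover have "m' x \<le> m x" if "x \<in> X" for x
    using m'_le[OF that, of 0] by (simp add: h_def)
  moreover have "m' x \<le> m (x + y) - m y" if "x \<in> X" for x
    using m'_le[OF that, of 1] by (simp add: h_def)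
  ultimately show ?thesis
    using that[of m'] by (simp add: m'_def)
qed

text \<open>
  Minimal sublinear functionals are linear by \<open>sublinear_tilt\<close>; this avoids extending partially
  defined functionals in the proof of Hahn--Banach.
\<close>

lemma minimal_sublinear_exists:
  assumes q: "sublinear q" "\<And>x. x \<notin> X \<Longrightarrow> q x = 0"
  obtains m where "sublinear m" "m \<le> q"
    "\<And>m' x. sublinear m' \<Longrightarrow> (\<And>y. y \<notin> X \<Longrightarrow> m' y = 0) \<Longrightarrow> (\<And>y. y \<in> X \<Longrightarrow> m' y \<le> m y) \<Longrightarrow> m' x = m x"
proof -
  \<comment> \<open>Fixing the value 0 outside \<open>X\<close> makes the pointwise order on the
    whole type coincide with the order on \<open>X\<close>.\<close>
  define A where "A = {m. sublinear m \<and> m \<le> q \<and> (\<forall>x. x \<notin> X \<longrightarrow> m x = 0)}"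
  \<comment> \<open>Zorn is used for the reversed order: a chain is bounded by its pointwise
    infimum, and a maximal element is a minimal functional.\<close>
  have "\<exists>m\<in>A. \<forall>m'\<in>A. m' \<le> m \<longrightarrow> m' = m"
  proof (rule predicate_Zorn)
    show "partial_order_on A (relation_of (\<lambda>a b. b \<le> a) A)"
      by (rule partial_order_on_relation_ofI) auto
    fix C assume C: "C \<in> Chains (relation_of (\<lambda>a b. b \<le> a) A)"
    then have CA: "C \<subseteq> A" and chain: "\<And>a b. a \<in> C \<Longrightarrow> b \<in> C \<Longrightarrow> a \<le> b \<or> b \<le> a"
      by (auto simp: Chains_def relation_of_def)
    show "\<exists>u\<in>A. \<forall>a\<in>C. u \<le> a"
    proof (cases "C = {}")
      case True
      then show ?thesis using q by (auto simp: A_def)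
    next
      case False
      define u where "u x = (if x \<in> X then INF m\<in>C. m x else 0)" for x
      have sub: "sublinear m" and le_q: "m x \<le> q x" and outside: "x \<notin> X \<Longrightarrow> m x = 0" if "m \<in> C" for m x
        using that CA by (auto simp: A_def le_fun_def)
      have lower: "- q (- x) \<le> m x" if "m \<in> C" "x \<in> X" for m x
        using sublinear_lower[OF sub[OF that(1)] that(2)] le_q[OF that(1), of "- x"] by simp
      have u_le: "u x \<le> m x" if "m \<in> C" for m x
        unfolding u_def using that lower outside[OF that]
        by (auto intro!: cINF_lower bdd_belowI2[where m="- q (- x)"])
      have u_ge: "a \<le> u x" if "x \<in> X" "\<And>m. m \<in> C \<Longrightarrow> a \<le> m x" for a x
        unfolding u_def using that False by (auto intro!: cINF_greatest)
      have "sublinear u"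
        unfolding sublinear_def
      proof (intro conjI ballI allI impI)
        fix x z assume x: "x \<in> X" and z: "z \<in> X"
        \<comment> \<open>Two members of a chain are comparable, so the smaller one bounds both
          terms and its own subadditivity suffices.\<close>
        have *: "u (x + z) \<le> m x + n z" if mn: "m \<in> C" "n \<in> C" for m n
          using chain[OF mn]
        proof
          assume "m \<le> n"
          then have "m z \<le> n z" by (simp add: le_fun_def)
          then show ?thesis
            using u_le[OF mn(1), of "x + z"] sublinear_add[OF sub[OF mn(1)] x z] by simp
        next
          assume "n \<le> m"
          then have "n x \<le> m x" by (simp add: le_fun_def)
          then show ?thesis
            using u_le[OF mn(2), of "x + z"] sublinear_add[OF sub[OF mn(2)] x z] by simp
        qed
        have "u (x + z) - m x \<le> u z" if "m \<in> C" for m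
          using *[OF that] z by (intro u_ge) (auto simp: algebra_simps)
        then have "u (x + z) - u z \<le> u x"
          using x by (intro u_ge) (auto simp: algebra_simps)
        then show "u (x + z) \<le> u x + u z" by simp
      next
        fix t :: real and x assume t: "t > 0" and x: "x \<in> X"
        have "inverse t * u (scale (of_real t) x) \<le> m x" if "m \<in> C" for m
          using u_le[OF that, of "scale (of_real t) x"] sublinear_pos_scale[OF sub[OF that] x t] t
          by (simp add: field_simps)
        then have "inverse t * u (scale (of_real t) x) \<le> u x"
          using u_ge[OF x] by blast
        then show "u (scale (of_real t) x) \<le> t * u x"
          using t by (simp add: field_simps)
      qed
      moreover have "u \<le> q"
        using False u_le le_q by (meson equals0I le_funI order_trans)
      ultimately have "u \<in> A" by (simp add: A_def u_def)
      then show ?thesis using u_le by (auto simp: le_fun_def)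
    qed
  qed
  then obtain m where m: "m \<in> A" and min: "\<And>m'. m' \<in> A \<Longrightarrow> m' \<le> m \<Longrightarrow> m' = m" by blast
  show ?thesis
  proof (rule that[of m])
    fix m' x
    assume m': "sublinear m'" "\<And>y. y \<notin> X \<Longrightarrow> m' y = 0" "\<And>y. y \<in> X \<Longrightarrow> m' y \<le> m y"
    have "m' y \<le> m y" for y
      using m m'(2,3)[of y] by (cases "y \<in> X") (auto simp: A_def)
    then have "m' \<le> m" by (simp add: le_fun_def)
    moreover have "m \<le> q" using m by (simp add: A_def)
    ultimately have "m' \<in> A" using m'(1,2) by (auto simp: A_def)
    from min[OF this \<open>m' \<le> m\<close>] show "m' x = m x" by simp
  qed (use m in \<open>auto simp: A_def\<close>)
qed

text \<open>Tilting \<open>q\<close> in the direction \<open>g\<close> before minimising fixes the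
  value at \<open>g\<close>: a minorant of the tilted functional is at most \<open>- q g\<close> at
  \<open>- g\<close>, so a linear one is at least \<open>q g\<close> at \<open>g\<close>.\<close>

lemma Hahn_Banach_real:
  assumes q: "sublinear q" and g: "g \<in> X"
  obtains F where "\<And>x y. x \<in> X \<Longrightarrow> y \<in> X \<Longrightarrow> F (x + y) = F x + F y"
    "\<And>t x. x \<in> X \<Longrightarrow> F (scale (of_real t) x) = t * F x"
    "\<And>x. x \<in> X \<Longrightarrow> F x \<le> q x" "F g = q g"
proof -
  obtain q' where q': "sublinear q'" "\<And>x. x \<notin> X \<Longrightarrow> q' x = 0" "\<And>x. x \<in> X \<Longrightarrow> q' x \<le> q x"
    "\<And>x. x \<in> X \<Longrightarrow> q' x \<le> q (x + g) - q g"
    using sublinear_tilt[OF q g] by blast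
  obtain m where m: "sublinear m" "m \<le> q'"
    and min: "\<And>m' x. sublinear m' \<Longrightarrow> (\<And>y. y \<notin> X \<Longrightarrow> m' y = 0) \<Longrightarrow> (\<And>y. y \<in> X \<Longrightarrow> m' y \<le> m y)
      \<Longrightarrow> m' x = m x"
    using minimal_sublinear_exists[OF q'(1,2)] by blast
  have m_q': "m x \<le> q' x" for x
    using m(2) by (simp add: le_fun_def)
  have add: "m (x + y) = m x + m y" if x: "x \<in> X" and y: "y \<in> X" for x y
  proof (rule antisym)
    show "m (x + y) \<le> m x + m y"
      by (rule sublinear_add[OF m(1) x y])
    \<comment> \<open>By minimality the tilt of \<open>m\<close> in the direction \<open>y\<close>
      cannot lower \<open>m\<close>, which yields the reverse inequality.\<close>
    obtain m' where *: "sublinear m'" "\<And>x. x \<notin> X \<Longrightarrow> m' x = 0" "\<And>x. x \<in> X \<Longrightarrow> m' x \<le> m x"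
      and m': "\<And>x. x \<in> X \<Longrightarrow> m' x \<le> m (x + y) - m y"
      using sublinear_tilt[OF m(1) y] by blast
    have "m' x = m x"
      by (rule min[OF *])
    with m'[OF x] show "m x + m y \<le> m (x + y)" by simp
  qed
  have neg: "m (- x) = - m x" if "x \<in> X" for x
    using add[OF that X_neg[OF that]] sublinear_zero[OF m(1)] by simp
  have scale: "m (scale (of_real t) x) = t * m x" if x: "x \<in> X" for t x
  proof -
    consider "t > 0" | "t = 0" | "- t > 0" by linarith
    then show ?thesis
    proof cases
      case 1
      then show ?thesis using sublinear_pos_scale[OF m(1) x] by simp
    next
      case 2
      then show ?thesis using sublinear_zero[OF m(1)] by simp
    next
      case 3
      then show ?thesis
        using sublinear_pos_scale[OF m(1) x 3] neg[OF X_scale[OF x, of "of_real t"]] by simp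
    qed
  qed
  have "m (- g) \<le> q' (- g)"
    by (rule m_q')
  also have "\<dots> \<le> - q g"
    using q'(4)[OF X_neg[OF g]] sublinear_zero[OF q] by simp
  finally have "q g \<le> m g"
    using neg[OF g] by simp
  moreover have "m x \<le> q x" if "x \<in> X" for x
    using q'(3)[OF that] m_q'[of x] by simp
  ultimately show ?thesis
    using that[of m] add scale g by (simp add: antisym)
qed

text \<open>
  The real functional \<open>F\<close> is dominated by the distance to \<open>R\<close>, so it vanishes on \<open>R\<close>; its
  complexification \<open>f \<mapsto> F f - i F (i f)\<close> does so as well because \<open>R\<close> is invariant under \<open>i\<close>.
\<close>

lemma Hahn_Banach_separation:
  assumes N: "norm_on scale X N" and R: "subspace R" "R \<subseteq> X" and g: "g \<in> X"
    and \<delta>: "\<delta> > 0" "\<And>r. r \<in> R \<Longrightarrow> \<delta> \<le> N (g - r)"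
  obtains F where "F \<in> dual_on scale X N" "\<And>r. r \<in> R \<Longrightarrow> F r = 0" "F g \<noteq> 0"
proof -
  have N_nonneg: "x \<in> X \<Longrightarrow> 0 \<le> N x"
    and N_scale: "x \<in> X \<Longrightarrow> N (scale a x) = cmod a * N x"
    and N_add: "x \<in> X \<Longrightarrow> y \<in> X \<Longrightarrow> N (x + y) \<le> N x + N y" for a x y
    using N by (auto simp: norm_on_def)
  have RX: "x - r \<in> X" if "x \<in> X" "r \<in> R" for x r
    using that R by (auto intro: X_diff)
  \<comment> \<open>\<open>q\<close> is the distance to \<open>R\<close>. The hypothesis on \<delta>
    bounds it below at \<open>g\<close>, and \<open>F g = q g\<close> then keeps \<open>F g\<close>
    away from 0.\<close>
  define q where "q x = (INF r\<in>R. N (x - r))" for x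
  have q_le: "q x \<le> N (x - r)" if "x \<in> X" "r \<in> R" for x r
    unfolding q_def using that RX N_nonneg by (auto intro!: cINF_lower bdd_belowI2[where m=0])
  have q_ge: "a \<le> q x" if "\<And>r. r \<in> R \<Longrightarrow> a \<le> N (x - r)" for a x
    unfolding q_def using that subspace_0[OF R(1)] by (auto intro!: cINF_greatest)
  have "sublinear q"
    unfolding sublinear_def
  proof (intro conjI ballI allI impI)
    fix x y assume x: "x \<in> X" and y: "y \<in> X"
    have *: "q (x + y) \<le> N (x - r) + N (y - r')" if "r \<in> R" "r' \<in> R" for r r'
    proof -
      have "q (x + y) \<le> N ((x + y) - (r + r'))"
        using x y that by (intro q_le X_add subspace_add R)
      also have "\<dots> = N ((x - r) + (y - r'))"
        by (simp add: algebra_simps)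
      also have "\<dots> \<le> N (x - r) + N (y - r')"
        using x y that by (intro N_add RX)
      finally show ?thesis .
    qed
    have "q (x + y) - N (x - r) \<le> q y" if "r \<in> R" for r
      using *[OF that] by (intro q_ge) (auto simp: algebra_simps)
    then have "q (x + y) - q y \<le> q x"
      by (intro q_ge) (auto simp: algebra_simps)
    then show "q (x + y) \<le> q x + q y" by simp
  next
    fix t :: real and x assume t: "t > 0" and x: "x \<in> X"
    \<comment> \<open>\<open>R\<close> is invariant under scaling, so \<open>r\<close> may be
      replaced by its multiple by \<open>t\<close>.\<close>
    have "inverse t * q (scale (of_real t) x) \<le> N (x - r)" if "r \<in> R" for r
    proof -
      have "q (scale (of_real t) x) \<le> N (scale (of_real t) x - scale (of_real t) r)"
        using x that by (intro q_le X_scale subspace_scale R)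
      also have "\<dots> = t * N (x - r)"
        using N_scale[OF RX[OF x that], of "of_real t"] t by (simp add: scale_right_diff_distrib)
      finally show ?thesis using t by (simp add: field_simps)
    qed
    from q_ge[OF this] show "q (scale (of_real t) x) \<le> t * q x"
      using t by (simp add: field_simps)
  qed
  then obtain F where add: "\<And>x y. x \<in> X \<Longrightarrow> y \<in> X \<Longrightarrow> F (x + y) = F x + F y"
    and scl: "\<And>t x. x \<in> X \<Longrightarrow> F (scale (of_real t) x) = t * F x"
    and F_q: "\<And>x. x \<in> X \<Longrightarrow> F x \<le> q x" and F_g: "F g = q g"
    using Hahn_Banach_real[OF _ g] by metis
  have neg: "F (- x) = - F x" if "x \<in> X" for x
    using scl[OF that, of "- 1"] by simp
  have F_le: "\<bar>F x\<bar> \<le> N x" if x: "x \<in> X" for x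
  proof -
    have *: "F x \<le> N x" if "x \<in> X" for x
      using F_q[OF that] q_le[OF that subspace_0[OF R(1)]] by simp
    have "N (- x) = N x"
      using N_scale[OF x, of "- 1"] by simp
    then show ?thesis
      using *[OF x] *[OF X_neg[OF x]] neg[OF x] by simp
  qed
  have N_0: "N 0 = 0"
    using N_scale[OF X_zero, of 0] by simp
  have F_R: "F r = 0" if r: "r \<in> R" for r
  proof -
    \<comment> \<open>The distance from \<open>r\<close> to \<open>R\<close> is at most
      \<open>N (r - r)\<close>, that is 0; the same bound at \<open>- r\<close> gives
      equality.\<close>
    have *: "F r \<le> 0" if "r \<in> R" for r
      using F_q[of r] q_le[of r r] that R N_0 by auto
    show ?thesis
      using *[OF r] *[OF subspace_neg[OF R(1) r]] neg[of r] r R by auto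
  qed
  define G where "G x = (if x \<in> X then Complex (F x) (- F (scale \<i> x)) else 0)" for x
  have "G \<in> dual_on scale X N"
    unfolding dual_on_def
  proof (intro CollectI conjI ballI allI impI)
    fix x y assume "x \<in> X" "y \<in> X"
    then show "G (x + y) = G x + G y"
      by (simp add: G_def X_add X_scale add scale_right_distrib complex_eq_iff)
  next
    fix a x assume x: "x \<in> X"
    \<comment> \<open>Real linearity expresses \<open>F\<close> on complex multiples of
      \<open>x\<close> through two values; taking \<open>b\<close> to be \<open>a\<close> and
      \<open>\<i> * a\<close> gives the real and imaginary parts of homogeneity.\<close>
    have Fa: "F (scale b x) = Re b * F x + Im b * F (scale \<i> x)" for b
    proof -
      have "scale b x = scale (of_real (Re b)) x + scale (of_real (Im b)) (scale \<i> x)"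
        by (subst complex_eq[of b]) (simp only: scale_left_distrib scale_scale mult.commute)
      then show ?thesis
        using x by (simp only: add scl X_scale)
    qed
    show "G (scale a x) = a * G x"
      using x Fa[of a] Fa[of "\<i> * a"] by (simp add: G_def X_scale complex_eq_iff)
  next
    have "cmod (G x) \<le> 2 * N x" if x: "x \<in> X" for x
    proof -
      have "cmod (G x) \<le> \<bar>F x\<bar> + \<bar>F (scale \<i> x)\<bar>"
        using cmod_le[of "G x"] x by (simp add: G_def)
      then show ?thesis
        using F_le[OF x] F_le[OF X_scale[OF x, of \<i>]] N_scale[OF x, of \<i>] by simp
    qed
    then show "\<exists>M. \<forall>x\<in>X. cmod (G x) \<le> M * N x" by blast
  qed (simp add: G_def)
  moreover have "G r = 0" if "r \<in> R" for r
    using that R(2) F_R[OF that] F_R[OF subspace_scale[OF R(1) that, of \<i>]]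
    by (auto simp: G_def complex_eq_iff)
  moreover have "\<delta> \<le> q g"
    using \<delta>(2) by (rule q_ge)
  then have "G g \<noteq> 0"
    using \<delta>(1) F_g g by (simp add: G_def complex_eq_iff)
  ultimately show ?thesis using that by blast
qed

end

section \<open>The dual norm\<close>

lemma vector_space_scale_fun: "vector_space (scale_fun :: complex \<Rightarrow> ('b \<Rightarrow> complex) \<Rightarrow> _)"
  by unfold_locales (auto simp: scale_fun_def fun_eq_iff algebra_simps)

locale normed_complex_subspace = complex_subspace scale X
  for scale :: "complex \<Rightarrow> 'b::ab_group_add \<Rightarrow> 'b" and X +
  fixes p :: "'b \<Rightarrow> real"
  assumes norm_p: "norm_on scale X p"
begin

lemma p_nonneg: "x \<in> X \<Longrightarrow> 0 \<le> p x"
  and p_eq_0: "x \<in> X \<Longrightarrow> p x = 0 \<longleftrightarrow> x = 0"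
  and p_scale: "x \<in> X \<Longrightarrow> p (scale a x) = cmod a * p x"
  using norm_p by (auto simp: norm_on_def)

lemma dual_norm_le:
  assumes "M \<ge> 0" "\<And>x. x \<in> X \<Longrightarrow> cmod (f x) \<le> M * p x"
  shows "dual_norm X p f \<le> M"
  unfolding dual_norm_def
proof (rule cSUP_least)
  show "{x \<in> X. p x \<le> 1} \<noteq> {}"
    using X_zero p_eq_0[of 0] by auto
  show "cmod (f x) \<le> M" if "x \<in> {x \<in> X. p x \<le> 1}" for x
    using assms(2)[of x] that mult_left_mono[of "p x" 1 M] assms(1) by auto
qed

text \<open>The supremum yields upper bounds only once its set is bounded above. Membership in the
  dual provides this, with \<open>\<bar>M\<bar>\<close> because \<open>M\<close> may be negative;
  normalising \<open>x\<close> then leaves the unit ball.\<close>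

lemma
  assumes f: "f \<in> dual_on scale X p"
  shows dual_norm_nonneg: "0 \<le> dual_norm X p f"
    and dual_norm_bound: "x \<in> X \<Longrightarrow> cmod (f x) \<le> dual_norm X p f * p x"
proof -
  obtain M where M: "\<And>x. x \<in> X \<Longrightarrow> cmod (f x) \<le> M * p x"
    and f_scale: "\<And>a x. x \<in> X \<Longrightarrow> f (scale a x) = a * f x"
    using f unfolding dual_on_def by blast
  have unit: "cmod (f x) \<le> dual_norm X p f" if "x \<in> X" "p x \<le> 1" for x
    unfolding dual_norm_def
  proof (rule cSUP_upper)
    show "bdd_above ((\<lambda>x. cmod (f x)) ` {x \<in> X. p x \<le> 1})"
    proof (rule bdd_aboveI2)
      fix x assume "x \<in> {x \<in> X. p x \<le> 1}"
      then have "x \<in> X" "p x \<le> 1" by auto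
      then have "cmod (f x) \<le> \<bar>M\<bar> * p x"
        using M[of x] p_nonneg[of x] by (meson abs_ge_self mult_right_mono order_trans)
      also have "\<dots> \<le> \<bar>M\<bar>"
        using \<open>p x \<le> 1\<close> mult_left_mono[of "p x" 1 "\<bar>M\<bar>"] by simp
      finally show "cmod (f x) \<le> \<bar>M\<bar>" .
    qed
  qed (use that in auto)
  show "0 \<le> dual_norm X p f"
    by (rule order_trans[OF norm_ge_zero unit[OF X_zero]]) (use p_eq_0[OF X_zero] in simp)
  show "cmod (f x) \<le> dual_norm X p f * p x" if x: "x \<in> X"
  proof (cases "p x = 0")
    case True
    then show ?thesis using M[OF x] by simp
  next
    case False
    then have pos: "p x > 0" using p_nonneg[OF x] by simp
    then have "cmod (f (scale (of_real (inverse (p x))) x)) \<le> dual_norm X p f"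
      using x p_scale[OF x, of "of_real (inverse (p x))"]
      by (intro unit X_scale) (auto simp: norm_inverse)
    then show ?thesis
      using pos f_scale[OF x] by (simp add: norm_mult norm_divide norm_inverse field_simps)
  qed
qed

lemma subspace_dual: "module.subspace scale_fun (dual_on scale X p)"
proof -
  interpret fn: vector_space "scale_fun :: complex \<Rightarrow> ('b \<Rightarrow> complex) \<Rightarrow> _"
    by (rule vector_space_scale_fun)
  show ?thesis
  proof (rule fn.subspaceI)
    show "0 \<in> dual_on scale X p"
      by (auto simp: dual_on_def intro!: exI[of _ 0])
  next
    fix f g assume f: "f \<in> dual_on scale X p" and g: "g \<in> dual_on scale X p"
    have "cmod ((f + g) x) \<le> (dual_norm X p f + dual_norm X p g) * p x" if "x \<in> X" for x
      using dual_norm_bound[OF f that] dual_norm_bound[OF g that] norm_triangle_ineq[of "f x" "g x"]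
      by (simp add: algebra_simps)
    then have "\<exists>M. \<forall>x\<in>X. cmod ((f + g) x) \<le> M * p x" by blast
    then show "f + g \<in> dual_on scale X p"
      using f g by (simp add: dual_on_def algebra_simps)
  next
    fix a f assume f: "f \<in> dual_on scale X p"
    have "cmod (scale_fun a f x) \<le> (cmod a * dual_norm X p f) * p x" if "x \<in> X" for x
      using dual_norm_bound[OF f that] by (simp add: scale_fun_def norm_mult mult.assoc mult_left_mono)
    then have "\<exists>M. \<forall>x\<in>X. cmod (scale_fun a f x) \<le> M * p x" by blast
    then show "scale_fun a f \<in> dual_on scale X p"
      using f by (simp add: dual_on_def scale_fun_def algebra_simps)
  qed
qed

text \<open>Separating functionals obtained inside the dual are elements of the bidual, where
  reflexivity can be used.\<close>

sublocale dual: complex_subspace scale_fun "dual_on scale X p"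
  by (rule complex_subspace.intro[OF vector_space_scale_fun])
    (simp add: complex_subspace_axioms_def subspace_dual)

lemma norm_on_dual: "norm_on scale_fun (dual_on scale X p) (dual_norm X p)"
  unfolding norm_on_def
proof (intro conjI ballI allI)
  fix f assume f: "f \<in> dual_on scale X p"
  show "0 \<le> dual_norm X p f" by (rule dual_norm_nonneg[OF f])
  show "dual_norm X p f = 0 \<longleftrightarrow> f = 0"
  proof
    assume "dual_norm X p f = 0"
    \<comment> \<open>Vanishing outside \<open>X\<close> is what makes \<open>f\<close> zero as a
      function, so that the dual norm is definite.\<close>
    then have "f x = 0" for x
      using dual_norm_bound[OF f, of x] f by (cases "x \<in> X") (auto simp: dual_on_def)
    then show "f = 0" by (simp add: fun_eq_iff)
  next
    assume "f = 0"
    then show "dual_norm X p f = 0"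
      using dual_norm_nonneg[OF f] dual_norm_le[of 0 f] by simp
  qed
  fix a
  have le: "dual_norm X p (scale_fun b g) \<le> cmod b * dual_norm X p g"
    if "g \<in> dual_on scale X p" for b g
    using dual_norm_bound[OF that] dual_norm_nonneg[OF that]
    by (intro dual_norm_le) (auto simp: scale_fun_def norm_mult mult.assoc mult_left_mono)
  show "dual_norm X p (scale_fun a f) = cmod a * dual_norm X p f"
  proof (cases "a = 0")
    case True
    then show ?thesis using le[OF f, of 0] dual_norm_nonneg[OF dual.X_scale[OF f, of 0]] by simp
  next
    case False
    \<comment> \<open>The reverse inequality is \<open>le\<close> for the inverse scalar.\<close>
    have "dual_norm X p (scale_fun (inverse a) (scale_fun a f))
        \<le> cmod (inverse a) * dual_norm X p (scale_fun a f)"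
      by (rule le[OF dual.X_scale[OF f]])
    then have "cmod a * dual_norm X p f \<le> dual_norm X p (scale_fun a f)"
      using False by (simp add: norm_inverse norm_divide field_simps)
    with le[OF f, of a] show ?thesis by simp
  qed
next
  fix f g assume f: "f \<in> dual_on scale X p" and g: "g \<in> dual_on scale X p"
  have "cmod ((f + g) x) \<le> (dual_norm X p f + dual_norm X p g) * p x" if "x \<in> X" for x
    using dual_norm_bound[OF f that] dual_norm_bound[OF g that] norm_triangle_ineq[of "f x" "g x"]
    by (simp add: algebra_simps)
  then show "dual_norm X p (f + g) \<le> dual_norm X p f + dual_norm X p g"
    using dual_norm_nonneg[OF f] dual_norm_nonneg[OF g] by (intro dual_norm_le) auto
qed

end

section \<open>Lax--Milgram on a reflexive space\<close>

text \<open>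
  The functionals \<open>y \<mapsto> cnj (A x y)\<close> form a subspace of the dual, closed by coercivity and
  completeness. If it were proper, Hahn--Banach and reflexivity would give \<open>y \<noteq> 0\<close> with \<open>A x y = 0\<close>
  for all \<open>x\<close>, contradicting coercivity at \<open>x = y\<close>.
\<close>

lemma Lax_Milgram_reflexive:
  fixes D :: "'a::complex_hilbert_space set"
  assumes refl: "reflexive_banach_on scaleC D p" and form: "sesquilinear_on D A"
    and bound: "\<And>x y. x \<in> D \<Longrightarrow> y \<in> D \<Longrightarrow> cmod (A x y) \<le> \<beta> * p x * p y"
    and c: "c > 0" and coercive: "\<And>x. x \<in> D \<Longrightarrow> c * (p x)\<^sup>2 \<le> cmod (A x x)"
    and \<Lambda>: "\<Lambda> \<in> conj_dual_on scaleC D p"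
  shows "\<exists>x\<in>D. \<forall>y\<in>D. \<Lambda> y = A x y"
proof -
  interpret normed_complex_subspace scaleC D p
    using refl unfolding reflexive_banach_on_def banach_on_def
    by (simp add: normed_complex_subspace_def complex_subspace_def vector_space_scaleC
        complex_subspace_axioms_def normed_complex_subspace_axioms_def)
  have A_add: "A (x + y) z = A x z + A y z" "A z (x + y) = A z x + A z y"
    and A_scale: "A (scaleC a x) z = a * A x z" "A z (scaleC a x) = cnj a * A z x"
    if "x \<in> D" "y \<in> D" "z \<in> D" for x y z a
    using form that by (auto simp: sesquilinear_on_def)
  have A_diff: "A (x - y) z = A x z - A y z" if "x \<in> D" "y \<in> D" "z \<in> D" for x y z
    using A_add(1)[of "x - y" y z] that X_diff by simp
  define T where "T x = (\<lambda>y. if y \<in> D then cnj (A x y) else 0)" for x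
  define g where "g = (\<lambda>y. cnj (\<Lambda> y))"
  have T_dual: "T x \<in> dual_on scaleC D p" if x: "x \<in> D" for x
  proof -
    have "\<exists>M. \<forall>y\<in>D. cmod (T x y) \<le> M * p y"
      using bound[OF x] by (intro exI[of _ "\<beta> * p x"]) (simp add: T_def)
    then show ?thesis
      using x by (simp add: dual_on_def T_def X_add X_scale A_add A_scale)
  qed
  have g_dual: "g \<in> dual_on scaleC D p"
    using \<Lambda> by (auto simp: dual_on_def conj_dual_on_def g_def)
  have R: "dual.subspace (T ` D)"
  proof (rule dual.subspaceI)
    have "T 0 = 0"
      using A_scale(1)[OF X_zero X_zero, of _ 0] by (auto simp: T_def fun_eq_iff)
    then show "0 \<in> T ` D"
      using X_zero by (metis imageI)
  next
    fix f h assume "f \<in> T ` D" "h \<in> T ` D"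
    then obtain x y where xy: "x \<in> D" "y \<in> D" and fh: "f = T x" "h = T y" by blast
    have "f + h = T (x + y)"
      using xy by (auto simp: fh T_def A_add fun_eq_iff)
    then show "f + h \<in> T ` D" using xy X_add by blast
  next
    fix a f assume "f \<in> T ` D"
    then obtain x where x: "x \<in> D" and f: "f = T x" by blast
    have "scale_fun a f = T (scaleC (cnj a) x)"
      using x by (auto simp: f T_def scale_fun_def A_scale fun_eq_iff)
    then show "scale_fun a f \<in> T ` D" using x X_scale by blast
  qed
  \<comment> \<open>Evaluating \<open>T x\<close> at \<open>x\<close> itself turns coercivity into a
    lower bound for \<open>T\<close>, so convergent images have Cauchy preimages.\<close>
  have T_lower: "c * p x \<le> dual_norm D p (T x)" if x: "x \<in> D" for x
  proof (cases "p x = 0")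
    case True
    then show ?thesis using dual_norm_nonneg[OF T_dual[OF x]] by simp
  next
    case False
    have "c * (p x)\<^sup>2 \<le> dual_norm D p (T x) * p x"
      using coercive[OF x] dual_norm_bound[OF T_dual[OF x] x] x by (simp add: T_def)
    then show ?thesis
      using False p_nonneg[OF x] by (simp add: power2_eq_square)
  qed
  have T_diff: "T x - T y = T (x - y)" if "x \<in> D" "y \<in> D" for x y
    using that by (auto simp: T_def A_diff fun_eq_iff)
  let ?N = "dual_norm D p"
  have N_add: "?N (f + h) \<le> ?N f + ?N h"
    if "f \<in> dual_on scaleC D p" "h \<in> dual_on scaleC D p" for f h
    using norm_on_dual that by (simp add: norm_on_def)
  have N_scale: "?N (scale_fun a f) = cmod a * ?N f" if "f \<in> dual_on scaleC D p" for a f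
    using norm_on_dual that by (simp add: norm_on_def)
  have "g \<in> T ` D"
  proof (rule ccontr)
    assume g_notin: "g \<notin> T ` D"
    have "\<exists>\<delta>>0. \<forall>x\<in>D. \<delta> \<le> ?N (g - T x)"
    proof (rule ccontr)
      assume "\<not> ?thesis"
      then have "\<exists>x\<in>D. ?N (g - T x) < \<delta>" if "\<delta> > 0" for \<delta>
        using that by force
      then have "\<exists>x\<in>D. ?N (g - T x) < inverse (real (Suc n))" for n
        by simp
      then obtain X where X: "\<And>n. X n \<in> D" "\<And>n. ?N (g - T (X n)) < inverse (real (Suc n))"
        by metis
      \<comment> \<open>\<open>g\<close> is inserted between the two images, leaving the two
        approximation errors.\<close>
      have p_X: "c * p (X m - X n) \<le> ?N (g - T (X n)) + ?N (g - T (X m))" for m n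
      proof -
        have "c * p (X m - X n) \<le> ?N (T (X m) - T (X n))"
          using T_lower[of "X m - X n"] X(1) X_diff T_diff by simp
        also have "T (X m) - T (X n) = (g - T (X n)) + scale_fun (- 1) (g - T (X m))"
          by (auto simp: scale_fun_def fun_eq_iff)
        also have "?N \<dots> \<le> ?N (g - T (X n)) + ?N (scale_fun (- 1) (g - T (X m)))"
          using X(1) by (intro N_add dual.X_scale dual.X_diff g_dual T_dual)
        also have "?N (scale_fun (- 1) (g - T (X m))) = ?N (g - T (X m))"
          using N_scale[OF dual.X_diff[OF g_dual T_dual[OF X(1)]], of "- 1"] by simp
        finally show ?thesis .
      qed
      have "Cauchy_wrt p X"
        unfolding Cauchy_wrt_def
      proof (intro allI impI)
        fix e :: real assume "e > 0"
        then obtain K where K: "inverse (real (Suc K)) < c * e / 2"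
          using c reals_Archimedean[of "c * e / 2"] by auto
        have "p (X m - X n) < e" if "m \<ge> K" "n \<ge> K" for m n
        proof -
          have small: "?N (g - T (X k)) < c * e / 2" if "k \<ge> K" for k
          proof -
            have "inverse (real (Suc k)) \<le> inverse (real (Suc K))"
              using that by (simp add: field_simps)
            then show ?thesis using X(2)[of k] K by linarith
          qed
          have "c * p (X m - X n) < c * e"
            using p_X[of m n] small[OF that(1)] small[OF that(2)] by simp
          then show ?thesis using c by simp
        qed
        then show "\<exists>K. \<forall>m\<ge>K. \<forall>n\<ge>K. p (X m - X n) < e" by blast
      qed
      then obtain x where x: "x \<in> D" and lim: "(\<lambda>n. p (X n - x)) \<longlonglongrightarrow> 0"
        using refl X(1) unfolding reflexive_banach_on_def banach_on_def by blast
      have "g y = T x y" if y: "y \<in> D" for y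
      proof -
        \<comment> \<open>The first term is the error of the approximant \<open>T (X n)\<close>, the
          second the continuity of \<open>A\<close> in its first variable; both tend to 0.\<close>
        have "cmod (g y - T x y) \<le> inverse (real (Suc n)) * p y + \<beta> * p (X n - x) * p y" for n
        proof -
          have "cmod (g y - T x y) \<le> cmod ((g - T (X n)) y) + cmod (T (X n - x) y)"
            using norm_triangle_ineq[of "(g - T (X n)) y" "T (X n - x) y"]
            by (simp flip: T_diff[OF X(1)[of n] x])
          moreover have "cmod ((g - T (X n)) y) \<le> ?N (g - T (X n)) * p y"
            using X(1) y by (intro dual_norm_bound dual.X_diff g_dual T_dual)
          moreover have "?N (g - T (X n)) * p y \<le> inverse (real (Suc n)) * p y"
            using X(2)[of n] p_nonneg[OF y] by (intro mult_right_mono) auto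
          moreover have "cmod (T (X n - x) y) \<le> \<beta> * p (X n - x) * p y"
            using bound[of "X n - x" y] X(1) x y X_diff by (simp add: T_def)
          ultimately show ?thesis by linarith
        qed
        moreover have "(\<lambda>n. inverse (real (Suc n)) * p y + \<beta> * p (X n - x) * p y)
            \<longlonglongrightarrow> 0 * p y + \<beta> * 0 * p y"
          by (intro tendsto_intros lim LIMSEQ_inverse_real_of_nat)
        ultimately have "cmod (g y - T x y) \<le> 0"
          by (intro LIMSEQ_le_const) auto
        then show ?thesis by simp
      qed
      moreover have "g y = T x y" if "y \<notin> D" for y
        using that g_dual by (simp add: T_def dual_on_def)
      ultimately have "g = T x" by (auto simp: fun_eq_iff)
      with g_notin x show False by blast
    qed
    then obtain \<delta> where \<delta>: "\<delta> > 0" "\<And>r. r \<in> T ` D \<Longrightarrow> \<delta> \<le> ?N (g - r)" by blast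
    obtain F where F: "F \<in> bidual_on scaleC D p" and F_R: "\<And>r. r \<in> T ` D \<Longrightarrow> F r = 0"
      and F_g: "F g \<noteq> 0"
      unfolding bidual_on_def
      using dual.Hahn_Banach_separation[OF norm_on_dual R _ g_dual \<delta>] T_dual by blast
    \<comment> \<open>Reflexivity turns \<open>F\<close> into evaluation at \<open>y\<close>.
      Vanishing at \<open>T y\<close> means \<open>A y y = 0\<close>, hence \<open>y = 0\<close> and
      \<open>F g = g 0 = 0\<close>.\<close>
    obtain y where y: "y \<in> D" and F_y: "\<And>f. f \<in> dual_on scaleC D p \<Longrightarrow> F f = f y"
      using refl F unfolding reflexive_banach_on_def by blast
    have "A y y = 0"
      using F_R[OF imageI[OF y]] F_y[OF T_dual[OF y]] y by (simp add: T_def)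
    then have "y = 0"
      using coercive[OF y] c p_eq_0[OF y] by (simp add: mult_le_0_iff)
    moreover have "g 0 = 0"
      using dual_norm_bound[OF g_dual X_zero] p_eq_0[OF X_zero] by simp
    ultimately show False
      using F_y[OF g_dual] F_g by simp
  qed
  then obtain x where "x \<in> D" "g = T x" by blast
  moreover have "\<Lambda> y = A x y" if "y \<in> D" for y
    using that fun_cong[OF \<open>g = T x\<close>, of y] by (simp add: g_def T_def)
  ultimately show ?thesis by blast
qed

section \<open>Coercivity from disjoint numerical ranges\<close>

lemma
  fixes x y z :: "'a::complex_hilbert_space"
  shows cinner_add_right: "cinner x (y + z) = cinner x y + cinner x z"
    and cinner_scaleC_right: "cinner x (scaleC a y) = cnj a * cinner x y"
  by (subst (1 2 3) cinner_commute, simp add: cinner_add_left)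
    (subst (1 2) cinner_commute, simp add: cinner_scaleC_left)

lemma norm_scaleC: "norm (scaleC a x) = cmod a * norm (x :: 'a::complex_hilbert_space)"
proof -
  have "complex_of_real ((norm (scaleC a x))\<^sup>2) = a * cnj a * complex_of_real ((norm x)\<^sup>2)"
    unfolding cinner_self[symmetric] cinner_scaleC_left cinner_scaleC_right by simp
  also have "\<dots> = complex_of_real ((cmod a * norm x)\<^sup>2)"
    by (simp add: power_mult_distrib flip: complex_norm_square)
  finally have "(norm (scaleC a x))\<^sup>2 = (cmod a * norm x)\<^sup>2"
    by (simp only: of_real_eq_iff)
  then show ?thesis by (simp add: power2_eq_iff_nonneg)
qed

text \<open>The triangle inequality belongs to the class, so expanding the square of
  \<open>norm (u + y)\<close> bounds the real part; rotating \<open>x\<close> by a phase makes the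
  inner product real and nonnegative.\<close>

lemma complex_Cauchy_Schwarz: "cmod (cinner x y) \<le> norm x * norm (y :: 'a::complex_hilbert_space)"
proof -
  have Re_le: "Re (cinner u y) \<le> norm u * norm y" for u
  proof -
    have "complex_of_real ((norm (u + y))\<^sup>2) =
        of_real ((norm u)\<^sup>2) + of_real ((norm y)\<^sup>2) + (cinner u y + cnj (cinner u y))"
      by (simp only: cinner_add_left cinner_add_right flip: cinner_self cinner_commute[of y u])
        (simp add: algebra_simps)
    then have "(norm (u + y))\<^sup>2 = (norm u)\<^sup>2 + (norm y)\<^sup>2 + 2 * Re (cinner u y)"
      by (simp add: complex_eq_iff)
    moreover have "(norm (u + y))\<^sup>2 \<le> (norm u + norm y)\<^sup>2"
      by (intro power_mono norm_triangle_ineq norm_ge_zero)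
    ultimately show ?thesis by (simp add: power2_sum)
  qed
  \<comment> \<open>If the inner product is 0 then so is \<open>a\<close>; in all cases its modulus
    is at most 1.\<close>
  define a where "a = cnj (sgn (cinner x y))"
  have "cmod (cinner x y) = Re (cinner (scaleC a x) y)"
  proof -
    have "a * cinner x y = of_real (cmod (cinner x y))"
      by (cases "cinner x y = 0")
        (simp_all add: a_def sgn_eq mult.commute[of "cnj _"] power2_eq_square flip: complex_norm_square)
    then show ?thesis by (simp add: cinner_scaleC_left)
  qed
  also have "\<dots> \<le> norm (scaleC a x) * norm y" by (rule Re_le)
  also have "\<dots> \<le> norm x * norm y"
    by (intro mult_right_mono) (simp_all add: norm_scaleC a_def norm_sgn)
  finally show ?thesis .
qed

lemma bounded_sesquilinear_form_cinner:
  "bounded_sesquilinear_form (\<lambda>x y :: 'a::complex_hilbert_space. z * cinner x y)"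
  unfolding bounded_sesquilinear_form_def
proof
  show "sesquilinear_on UNIV (\<lambda>x y :: 'a. z * cinner x y)"
    by (simp add: sesquilinear_on_def cinner_add_left cinner_add_right cinner_scaleC_left
        cinner_scaleC_right algebra_simps)
  have "cmod (z * cinner x y) \<le> cmod z * norm x * norm y" for x y :: 'a
    using complex_Cauchy_Schwarz[of x y] by (simp add: norm_mult mult.assoc mult_left_mono)
  then show "\<exists>M. \<forall>x y :: 'a. cmod (z * cinner x y) \<le> M * norm x * norm y" by blast
qed

text \<open>Boundedness of \<Upsilon> supplies the compactness. On unit vectors the sum of the forms
  is a difference of points of the two ranges; homogeneity of degree two covers the other
  vectors.\<close>

lemma numerical_gap:
  fixes D :: "'a::complex_hilbert_space set"
  assumes subspace: "module.subspace scaleC D"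
    and form: "sesquilinear_on D \<Omega>" and \<Upsilon>: "bounded_sesquilinear_form \<Upsilon>"
    and disj: "closure (numerical_range D \<Omega>) \<inter> closure (numerical_range UNIV (\<lambda>x y. - \<Upsilon> x y)) = {}"
  obtains d where "d > 0" "\<And>x. x \<in> D \<Longrightarrow> d * (norm x)\<^sup>2 \<le> cmod (\<Omega> x x + \<Upsilon> x x)"
proof -
  interpret vector_space "scaleC :: complex \<Rightarrow> 'a \<Rightarrow> 'a"
    by (rule vector_space_scaleC)
  obtain M where M: "\<And>x y. cmod (\<Upsilon> x y) \<le> M * norm x * norm y"
    and \<Upsilon>_form: "sesquilinear_on UNIV \<Upsilon>"
    using \<Upsilon> by (auto simp: bounded_sesquilinear_form_def)
  have "bounded (numerical_range UNIV (\<lambda>x y. - \<Upsilon> x y))"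
    unfolding bounded_iff numerical_range_def
    using M by (intro exI[of _ M]) (auto, metis mult_1_right)
  then have "compact (closure (numerical_range UNIV (\<lambda>x y. - \<Upsilon> x y)))"
    by simp
  then obtain d where d: "d > 0"
    and gap: "\<And>u v. u \<in> closure (numerical_range UNIV (\<lambda>x y. - \<Upsilon> x y)) \<Longrightarrow>
      v \<in> closure (numerical_range D \<Omega>) \<Longrightarrow> d \<le> dist u v"
    using separate_compact_closed[of "closure (numerical_range UNIV (\<lambda>x y. - \<Upsilon> x y))"
        "closure (numerical_range D \<Omega>)"] disj by (metis closed_closure inf_commute)
  have unit: "d \<le> cmod (\<Omega> x x + \<Upsilon> x x)" if "x \<in> D" "norm x = 1" for x
  proof -
    have "d \<le> dist (- \<Upsilon> x x) (\<Omega> x x)"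
      using that by (intro gap closure_subset[THEN subsetD]) (auto simp: numerical_range_def)
    also have "\<dots> = cmod (\<Omega> x x + \<Upsilon> x x)"
      unfolding dist_norm by (metis add.commute minus_diff_eq diff_minus_eq_add norm_minus_cancel)
    finally show ?thesis .
  qed
  have "d * (norm x)\<^sup>2 \<le> cmod (\<Omega> x x + \<Upsilon> x x)" if x: "x \<in> D" for x
  proof (cases "x = 0")
    case True
    then show ?thesis by simp
  next
    case False
    define a where "a = complex_of_real (inverse (norm x))"
    have ax: "scaleC a x \<in> D"
      using subspace x by (simp add: subspace_scale)
    have "norm (scaleC a x) = 1"
      using False by (simp only: a_def flip: scaleR_scaleC) simp
    from unit[OF ax this] have "d \<le> cmod (a * cnj a * (\<Omega> x x + \<Upsilon> x x))"
      using form \<Upsilon>_form x ax by (simp add: sesquilinear_on_def algebra_simps)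
    also have "\<dots> = cmod (\<Omega> x x + \<Upsilon> x x) / (norm x)\<^sup>2"
      by (simp add: a_def norm_mult norm_inverse norm_divide power2_eq_square divide_inverse)
    finally show ?thesis
      using False by (simp add: pos_le_divide_eq)
  qed
  with d that show ?thesis by blast
qed

text \<open>The hypothesis on sequences carries no rate, so \<open>c\<close> arises by contradiction
  and is not explicit.\<close>

lemma coercive_of_numerical_gap:
  fixes D :: "'a::complex_hilbert_space set"
  assumes subspace: "module.subspace scaleC D" and norm: "norm_on scaleC D p"
    and form: "sesquilinear_on D \<Omega>" and \<Upsilon>: "bounded_sesquilinear_form \<Upsilon>"
    and cond: "\<And>X. (\<And>n. X n \<in> D) \<Longrightarrow> (\<lambda>n. norm (X n)) \<longlonglongrightarrow> 0 \<Longrightarrow>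
      (\<lambda>n. cmod (\<Omega> (X n) (X n))) \<longlonglongrightarrow> 0 \<Longrightarrow> (\<lambda>n. p (X n)) \<longlonglongrightarrow> 0"
    and d: "d > 0" "\<And>x. x \<in> D \<Longrightarrow> d * (norm x)\<^sup>2 \<le> cmod (\<Omega> x x + \<Upsilon> x x)"
  obtains c where "c > 0" "\<And>x. x \<in> D \<Longrightarrow> c * (p x)\<^sup>2 \<le> cmod (\<Omega> x x + \<Upsilon> x x)"
proof -
  interpret normed_complex_subspace scaleC D p
    using subspace norm
    by (simp add: normed_complex_subspace_def complex_subspace_def vector_space_scaleC
        complex_subspace_axioms_def normed_complex_subspace_axioms_def)
  obtain M where M: "\<And>x y. cmod (\<Upsilon> x y) \<le> M * norm x * norm y"
    and \<Upsilon>_form: "sesquilinear_on UNIV \<Upsilon>"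
    using \<Upsilon> by (auto simp: bounded_sesquilinear_form_def)
  define Q where "Q x = cmod (\<Omega> x x + \<Upsilon> x x)" for x
  have Q_scale: "Q (scaleC a x) = (cmod a)\<^sup>2 * Q x" if x: "x \<in> D" for a x
  proof -
    have "\<Omega> (scaleC a x) (scaleC a x) + \<Upsilon> (scaleC a x) (scaleC a x) = a * cnj a * (\<Omega> x x + \<Upsilon> x x)"
      using form \<Upsilon>_form x X_scale[OF x] by (simp add: sesquilinear_on_def algebra_simps)
    then show ?thesis by (simp add: Q_def norm_mult power2_eq_square)
  qed
  have "\<exists>c>0. \<forall>x\<in>D. c * (p x)\<^sup>2 \<le> Q x"
  proof (rule ccontr)
    assume "\<not> ?thesis"
    then have neg: "\<exists>x\<in>D. Q x < c * (p x)\<^sup>2" if "c > 0" for c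
      using that by (meson not_le)
    \<comment> \<open>\<open>Q\<close> and the square of \<open>p\<close> scale alike, so a
      violating vector can be normalised in \<open>p\<close>.\<close>
    have "\<exists>y\<in>D. p y = 1 \<and> Q y < inverse (real (Suc n))" for n
    proof -
      obtain x where x: "x \<in> D" "Q x < inverse (real (Suc n)) * (p x)\<^sup>2"
        using neg[of "inverse (real (Suc n))"] by auto
      have "p x \<noteq> 0"
      proof
        assume "p x = 0"
        then have "Q x < 0" using x(2) by simp
        then show False by (simp add: Q_def)
      qed
      then have pos: "p x > 0" using p_nonneg[OF x(1)] by simp
      let ?y = "scaleC (of_real (inverse (p x))) x"
      have "p ?y = 1"
        using pos p_scale[OF x(1), of "of_real (inverse (p x))"] by (simp only: norm_of_real) simp
      moreover have "Q ?y < inverse (real (Suc n))"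
        unfolding Q_scale[OF x(1)] norm_of_real using pos x(2) by (simp add: field_simps)
      ultimately show ?thesis using X_scale[OF x(1)] by blast
    qed
    then obtain Y where Y: "\<And>n. Y n \<in> D" "\<And>n. p (Y n) = 1" "\<And>n. Q (Y n) < inverse (real (Suc n))"
      by metis
    have lim_Q: "(\<lambda>n. Q (Y n)) \<longlonglongrightarrow> 0"
      by (rule tendsto_sandwich[OF _ _ tendsto_const LIMSEQ_inverse_real_of_nat])
        (use Y(3) in \<open>auto simp: Q_def less_imp_le\<close>)
    have lim_norm2: "(\<lambda>n. (norm (Y n))\<^sup>2) \<longlonglongrightarrow> 0"
    proof (rule tendsto_sandwich[OF _ _ tendsto_const])
      show "\<forall>\<^sub>F n in sequentially. (norm (Y n))\<^sup>2 \<le> Q (Y n) / d"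
        using d(2)[OF Y(1)] d(1) by (simp add: Q_def field_simps)
      show "(\<lambda>n. Q (Y n) / d) \<longlonglongrightarrow> 0"
        using tendsto_divide[OF lim_Q tendsto_const, of d] d(1) by simp
    qed simp
    then have lim_norm: "(\<lambda>n. norm (Y n)) \<longlonglongrightarrow> 0"
      using tendsto_real_sqrt[OF lim_norm2] by simp
    have "(\<lambda>n. cmod (\<Omega> (Y n) (Y n))) \<longlonglongrightarrow> 0"
    proof (rule tendsto_sandwich[OF _ _ tendsto_const])
      \<comment> \<open>\<open>cond\<close> concerns \<Omega> alone; \<Upsilon> is subtracted at a
        cost that vanishes with the norm.\<close>
      have "cmod (\<Omega> x x) \<le> Q x + M * (norm x)\<^sup>2" for x
        using norm_triangle_ineq4[of "\<Omega> x x + \<Upsilon> x x" "\<Upsilon> x x"] M[of x x]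
        by (simp add: Q_def power2_eq_square mult.assoc)
      then show "\<forall>\<^sub>F n in sequentially. cmod (\<Omega> (Y n) (Y n)) \<le> Q (Y n) + M * (norm (Y n))\<^sup>2"
        by simp
      show "(\<lambda>n. Q (Y n) + M * (norm (Y n))\<^sup>2) \<longlonglongrightarrow> 0"
        using tendsto_add[OF lim_Q tendsto_mult[OF tendsto_const lim_norm2], of M] by simp
    qed simp
    then have "(\<lambda>n. p (Y n)) \<longlonglongrightarrow> 0"
      by (rule cond[OF Y(1) lim_norm])
    then show False
      using Y(2) by (simp add: LIMSEQ_const_iff)
  qed
  then show ?thesis using that by (auto simp: Q_def)
qed

section \<open>Solvability from the coercive estimate\<close>

theorem theorem5p4:
  fixes D :: "'a::complex_hilbert_space set"
    and \<Omega> :: "'a \<Rightarrow> 'a \<Rightarrow> complex"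
    and p :: "'a \<Rightarrow> real"
  assumes subspace: "module.subspace scaleC D"
    and dense: "closure D = UNIV"
    and form: "sesquilinear_on D \<Omega>"
    and norm: "norm_on scaleC D p"
    and q_closed: "q_closed_wrt D \<Omega> p"
    and cond: "\<And>X :: nat \<Rightarrow> 'a. (\<And>n. X n \<in> D) \<Longrightarrow> (\<lambda>n. norm (X n)) \<longlonglongrightarrow> 0 \<Longrightarrow>
      (\<lambda>n. cmod (\<Omega> (X n) (X n))) \<longlonglongrightarrow> 0 \<Longrightarrow> (\<lambda>n. p (X n)) \<longlonglongrightarrow> 0"
  shows "(\<forall>\<Upsilon>. bounded_sesquilinear_form \<Upsilon> \<longrightarrow>
            closure (numerical_range D \<Omega>) \<inter> closure (numerical_range UNIV (\<lambda>x y. - \<Upsilon> x y)) = {} \<longrightarrow>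
            \<Upsilon> \<in> solving_forms D \<Omega> p \<and> solvable_wrt D \<Omega> p) \<and>
         (\<forall>z::complex. z \<notin> closure (numerical_range D \<Omega>) \<longrightarrow>
            (\<lambda>x y. - z * cinner x y) \<in> solving_forms D \<Omega> p \<and> solvable_wrt D \<Omega> p)"
proof -
  have main: "\<Upsilon> \<in> solving_forms D \<Omega> p \<and> solvable_wrt D \<Omega> p"
    if \<Upsilon>: "bounded_sesquilinear_form \<Upsilon>"
      and disj: "closure (numerical_range D \<Omega>) \<inter> closure (numerical_range UNIV (\<lambda>x y. - \<Upsilon> x y)) = {}"
    for \<Upsilon>
  proof -
    obtain d where d: "d > 0" "\<And>x. x \<in> D \<Longrightarrow> d * (norm x)\<^sup>2 \<le> cmod (\<Omega> x x + \<Upsilon> x x)"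
      using numerical_gap[OF subspace form \<Upsilon> disj] by blast
    obtain c where c: "c > 0" "\<And>x. x \<in> D \<Longrightarrow> c * (p x)\<^sup>2 \<le> cmod (\<Omega> x x + \<Upsilon> x x)"
      using coercive_of_numerical_gap[OF subspace norm form \<Upsilon> cond d] by blast
    obtain M where M: "\<And>x y. cmod (\<Upsilon> x y) \<le> M * norm x * norm y"
      and \<Upsilon>_form: "sesquilinear_on UNIV \<Upsilon>"
      using \<Upsilon> by (auto simp: bounded_sesquilinear_form_def)
    obtain \<alpha> \<beta> where \<alpha>: "\<alpha> > 0" "\<And>x. x \<in> D \<Longrightarrow> norm x \<le> \<alpha> * p x"
      and \<beta>: "\<And>x y. x \<in> D \<Longrightarrow> y \<in> D \<Longrightarrow> cmod (\<Omega> x y) \<le> \<beta> * p x * p y"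
      and refl: "reflexive_banach_on scaleC D p"
      using q_closed unfolding q_closed_wrt_def by blast
    \<comment> \<open>The embedding constant \<alpha> converts the norm bound on \<Upsilon> into a
      bound in \<open>p\<close>.\<close>
    have bound: "cmod (\<Omega> x y + \<Upsilon> x y) \<le> (\<beta> + \<bar>M\<bar> * \<alpha>\<^sup>2) * p x * p y" if x: "x \<in> D" and y: "y \<in> D" for x y
    proof -
      have "cmod (\<Upsilon> x y) \<le> \<bar>M\<bar> * (norm x * norm y)"
        using M[of x y] mult_right_mono[of M "\<bar>M\<bar>" "norm x * norm y"]
        by (simp add: mult.assoc) linarith
      also have "\<dots> \<le> \<bar>M\<bar> * ((\<alpha> * p x) * (\<alpha> * p y))"
        using \<alpha>(2)[OF x] \<alpha>(2)[OF y] by (intro mult_left_mono mult_mono') auto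
      finally show ?thesis
        using \<beta>[OF x y] norm_triangle_ineq[of "\<Omega> x y" "\<Upsilon> x y"]
        by (simp add: power2_eq_square algebra_simps)
    qed
    have sum_form: "sesquilinear_on D (\<lambda>x y. \<Omega> x y + \<Upsilon> x y)"
      using form \<Upsilon>_form by (simp add: sesquilinear_on_def algebra_simps)
    \<comment> \<open>Injectivity follows from the gap \<open>d\<close> at
      \<open>y = x\<close>.\<close>
    have "x = 0" if "x \<in> D" "\<forall>y\<in>D. \<Omega> x y + \<Upsilon> x y = 0" for x
      using d(2)[OF that(1)] d(1) that by (simp add: mult_le_0_iff)
    moreover have "\<exists>x\<in>D. \<forall>y\<in>D. \<Lambda> y = \<Omega> x y + \<Upsilon> x y" if "\<Lambda> \<in> conj_dual_on scaleC D p" for \<Lambda>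
      by (rule Lax_Milgram_reflexive[OF refl sum_form bound c that])
    ultimately have "\<Upsilon> \<in> solving_forms D \<Omega> p"
      using \<Upsilon> by (auto simp: solving_forms_def)
    then show ?thesis
      using q_closed by (auto simp: solvable_wrt_def)
  qed
  moreover have "(\<lambda>x y. - z * cinner x y) \<in> solving_forms D \<Omega> p \<and> solvable_wrt D \<Omega> p"
    if z: "z \<notin> closure (numerical_range D \<Omega>)" for z
  proof (rule main[OF bounded_sesquilinear_form_cinner])
    \<comment> \<open>On unit vectors the form takes only the value \<open>z\<close>, and a
      singleton is closed.\<close>
    have "closure (numerical_range UNIV (\<lambda>x y :: 'a. - (- z * cinner x y))) \<subseteq> {z}"
      by (intro closure_minimal) (auto simp: numerical_range_def cinner_self)
    then show "closure (numerical_range D \<Omega>) \<inter>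
        closure (numerical_range UNIV (\<lambda>x y :: 'a. - (- z * cinner x y))) = {}"
      using z by blast
  qed
  ultimately show ?thesis by blast
qed

end
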